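(* Let $p$ be a prime and $n\ge 1$, and let $M_n$ be the group whose elements are triples $[\vec{x},\vec{y},z]$ with $\vec{x},\vec{y}\in\mathbb{F}_p^n$, $z\in\mathbb{F}_p$, with multiplication \[ [\vec{x},\vec{y},z]\cdot[\vec{x}',\vec{y}',z'] = [\vec{x}+\vec{x}',\ \vec{y}+\vec{y}',\ z+z'+\langle\vec{x},\vec{y}'\rangle + f(\vec{y},\vec{y}')], \] where $\langle\vec{x},\vec{y}'\rangle=\sum_{i=1}^n x_iy_i'$ and $f(\vec{y},\vec{y}')=\sum_{i=1}^n\left\lfloor \frac{(y_i \bmod p)+(y_i'\bmod p)}{p}\right\rfloor$ (taken in $\mathbb{F}_p$). For every $\varepsilon>0$ there exists a positive integer $n_0=n_0(\varepsilon)$ such that for every prime $p$ and every $n\ge n_0$: if $B\subseteq M_n$ is a brick with $|B|>|M_n|^{3/4+\varepsilon}$, then $B\cdot B=\{b b' : b,b'\in B\}$ contains at least $|B|/p$ cosets of the center $G'=[\vec{0},\vec{0},\mathbb{F}_p]=\{[\vec 0,\vec 0,z]: z\in\mathbb{F}_p\}$ of $M_n$ (a nontrivial subgroup).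
   Context: For $y\in\mathbb{F}_p$, $y\bmod p\in\{0,1,\dots,p-1\}$ denotes $y$ regarded as an integer. This group $M_n$ (of order $p^{2n+1}$) is isomorphic to the extra special group $\langle a_1,b_1,\dots,a_n,b_n,c \mid [a_i,a_j]=[b_i,b_j]=1,\ [a_i,b_j]=1\ (i\ne j),\ [a_i,c]=[b_i,c]=1,\ [a_i,b_i]=c,\ a_i^p=c^p=1,\ b_i^p=c\rangle$. A subset $B\subseteq M_n$ is a brick if $B=\{[\vec{x},\vec{y},z]: \vec{x}\in X_1\times\dots\times X_n,\ \vec{y}\in Y_1\times\dots\times Y_n,\ z\in Z\}$ for some nonempty subsets $X_i,Y_i,Z\subseteq\mathbb{F}_p$. *)

theory Defs
  imports Complex_Main "HOL-Algebra.Coset" "HOL-Number_Theory.Residues"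
begin

definition group_center :: "('a, 'b) monoid_scheme \<Rightarrow> 'a set" where
  "group_center G = {c \<in> carrier G. \<forall>g\<in>carrier G. c \<otimes>\<^bsub>G\<^esub> g = g \<otimes>\<^bsub>G\<^esub> c}"

text \<open>The field with \<open>p\<close> elements is \<^term>\<open>residue_ring (int p)\<close>: its elements are the integers
  \<open>0, \<dots>, p - 1\<close> and its operations are those of the integers reduced modulo \<open>p\<close>. Thus an element is
  already its own representative, and \<open>y mod p\<close> in the definition of the cocycle is just \<open>y\<close>.\<close>

abbreviation Fp :: "nat \<Rightarrow> int set" where
  "Fp p \<equiv> carrier (residue_ring (int p))"

text \<open>A triple of \<open>n\<close>-vectors \<open>x\<close>, \<open>y\<close> and a scalar \<open>z\<close>; vectors are extensional functions on
  \<open>{1..n}\<close>, so that equality of triples is equality of coordinates.\<close>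

type_synonym triple = "(nat \<Rightarrow> int) \<times> (nat \<Rightarrow> int) \<times> int"

definition dotp :: "nat \<Rightarrow> (nat \<Rightarrow> int) \<Rightarrow> (nat \<Rightarrow> int) \<Rightarrow> int" where
  "dotp n x y = (\<Sum>i=1..n. x i * y i)"

definition carry :: "nat \<Rightarrow> nat \<Rightarrow> (nat \<Rightarrow> int) \<Rightarrow> (nat \<Rightarrow> int) \<Rightarrow> int" where
  "carry p n y y' = (\<Sum>i=1..n. \<lfloor>real_of_int (y i + y' i) / real p\<rfloor>)"

definition Mgrp :: "nat \<Rightarrow> nat \<Rightarrow> triple monoid" where
  "Mgrp p n =
    \<lparr>carrier = ({1..n} \<rightarrow>\<^sub>E Fp p) \<times> ({1..n} \<rightarrow>\<^sub>E Fp p) \<times> Fp p,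
     monoid.mult = (\<lambda>(x, y, z) (x', y', z').
       (\<lambda>i\<in>{1..n}. (x i + x' i) mod int p,
        \<lambda>i\<in>{1..n}. (y i + y' i) mod int p,
        (z + z' + dotp n x y' + carry p n y y') mod int p)),
     one = (\<lambda>i\<in>{1..n}. 0, \<lambda>i\<in>{1..n}. 0, 0)\<rparr>"

definition Mcenter :: "nat \<Rightarrow> nat \<Rightarrow> triple set" where
  "Mcenter p n = {(\<lambda>i\<in>{1..n}. 0, \<lambda>i\<in>{1..n}. 0, z) | z. z \<in> Fp p}"

definition brick :: "nat \<Rightarrow> nat \<Rightarrow> triple set \<Rightarrow> bool" where
  "brick p n B \<longleftrightarrow>
    (\<exists>X Y Z. (\<forall>i\<in>{1..n}. X i \<noteq> {} \<and> X i \<subseteq> Fp p) \<and>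
             (\<forall>i\<in>{1..n}. Y i \<noteq> {} \<and> Y i \<subseteq> Fp p) \<and>
             Z \<noteq> {} \<and> Z \<subseteq> Fp p \<and>
             B = Pi\<^sub>E {1..n} X \<times> Pi\<^sub>E {1..n} Y \<times> Z)"

lemma Fp_iff: "a \<in> Fp p \<longleftrightarrow> 0 \<le> a \<and> a < int p"
  by (auto simp: residue_ring_def)

lemma carry_div: "carry p n y y' = (\<Sum>i=1..n. (y i + y' i) div int p)"
proof -
  have "\<lfloor>real_of_int a / real p\<rfloor> = a div int p" for a
    using floor_divide_of_int_eq[of a "int p", where 'a = real] by simp
  then show ?thesis
    unfolding carry_def by metis
qed

lemma Mgrp_carrier: "(x, y, z) \<in> carrier (Mgrp p n) \<longleftrightarrow>
    x \<in> {1..n} \<rightarrow>\<^sub>E Fp p \<and> y \<in> {1..n} \<rightarrow>\<^sub>E Fp p \<and> z \<in> Fp p"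
  by (simp add: Mgrp_def)

lemma Mgrp_mult: "(x, y, z) \<otimes>\<^bsub>Mgrp p n\<^esub> (x', y', z') =
       (\<lambda>i\<in>{1..n}. (x i + x' i) mod int p,
        \<lambda>i\<in>{1..n}. (y i + y' i) mod int p,
        (z + z' + dotp n x y' + carry p n y y') mod int p)"
  by (simp add: Mgrp_def)

lemma Mgrp_one: "\<one>\<^bsub>Mgrp p n\<^esub> = (\<lambda>i\<in>{1..n}. 0, \<lambda>i\<in>{1..n}. 0, 0)"
  by (simp add: Mgrp_def)

lemma carry_cocycle:
  assumes "p > 0"
  shows "carry p n y y' + carry p n (\<lambda>i\<in>{1..n}. (y i + y' i) mod int p) y'' =
         carry p n y' y'' + carry p n y (\<lambda>i\<in>{1..n}. (y' i + y'' i) mod int p)"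
proof -
  have aux: "a div q + (a mod q + c) div q = (a + c) div q" if "q \<noteq> 0" for a c q :: int
  proof -
    have "a + c = (a mod q + c) + q * (a div q)"
      by (simp add: algebra_simps)
    then have "(a + c) div q = ((a mod q + c) + q * (a div q)) div q"
      by (rule arg_cong)
    also have "\<dots> = a div q + (a mod q + c) div q"
      using that by (rule div_mult_self2)
    finally show ?thesis by simp
  qed
  have q: "int p \<noteq> 0" using assms by simp
  have "(y i + y' i) div int p + ((y i + y' i) mod int p + y'' i) div int p =
        (y' i + y'' i) div int p + (y i + (y' i + y'' i) mod int p) div int p" for i
    using aux[OF q, of "y i + y' i" "y'' i"] aux[OF q, of "y' i + y'' i" "y i"]
    by (simp add: add_ac)
  then show ?thesis
    by (simp add: carry_div flip: sum.distrib)
qed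

lemma dotp_mod_left:
  "dotp n (\<lambda>i\<in>{1..n}. (x i + x' i) mod m) y mod m = (dotp n x y + dotp n x' y) mod m"
proof -
  have "(\<Sum>i=1..n. (x i + x' i) mod m * y i) mod m = (\<Sum>i=1..n. (x i + x' i) * y i) mod m"
    by (subst (1 2) mod_sum_eq[symmetric]) (simp add: mod_mult_left_eq)
  then show ?thesis
    by (simp add: dotp_def sum.distrib ring_distribs)
qed

lemma dotp_commute: "dotp n x y = dotp n y x"
  by (simp add: dotp_def mult.commute)

lemma group_Mgrp:
  assumes "prime p"
  shows "group (Mgrp p n)"
proof (rule groupI)
  have p: "p > 0" "int p > 0" using assms prime_gt_0_nat by auto
  note mems = Fp_iff PiE_iff restrict_extensional
  show "\<one>\<^bsub>Mgrp p n\<^esub> \<in> carrier (Mgrp p n)"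
    using p by (auto simp: Mgrp_one Mgrp_carrier mems)
  fix g assume g: "g \<in> carrier (Mgrp p n)"
  obtain x y z where [simp]: "g = (x, y, z)" by (cases g)
  have xyz: "x \<in> {1..n} \<rightarrow>\<^sub>E Fp p" "y \<in> {1..n} \<rightarrow>\<^sub>E Fp p" "z \<in> Fp p"
    using g by (auto simp: Mgrp_carrier)
  have y0: "(\<Sum>i=1..n. y i div int p) = 0"
    using xyz by (intro sum.neutral) (auto simp: mems)
  have restr: "restrict (\<lambda>i. u i mod int p) {1..n} = u" if "u \<in> {1..n} \<rightarrow>\<^sub>E Fp p" for u
    using that by (auto simp: mems restrict_def extensional_def fun_eq_iff)
  show "\<one>\<^bsub>Mgrp p n\<^esub> \<otimes>\<^bsub>Mgrp p n\<^esub> g = g"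
    using xyz restr[OF xyz(1)] restr[OF xyz(2)] y0
    by (simp add: Mgrp_one Mgrp_mult dotp_def carry_div Fp_iff cong: restrict_cong)
  define y1 where "y1 = (\<lambda>i\<in>{1..n}. (- y i) mod int p)"
  define x1 where "x1 = (\<lambda>i\<in>{1..n}. (- x i) mod int p)"
  define z1 where "z1 = (- (z + dotp n x1 y + carry p n y1 y)) mod int p"
  show "\<exists>h\<in>carrier (Mgrp p n). h \<otimes>\<^bsub>Mgrp p n\<^esub> g = \<one>\<^bsub>Mgrp p n\<^esub>"
  proof
    show "(x1, y1, z1) \<in> carrier (Mgrp p n)"
      using p by (auto simp: Mgrp_carrier x1_def y1_def z1_def mems)
    have "(z1 + z + dotp n x1 y + carry p n y1 y) mod int p
        = (z1 + (z + dotp n x1 y + carry p n y1 y)) mod int p"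
      by (simp add: add_ac)
    also have "\<dots> = 0"
      unfolding z1_def by (simp only: mod_add_left_eq) simp
    finally show "(x1, y1, z1) \<otimes>\<^bsub>Mgrp p n\<^esub> g = \<one>\<^bsub>Mgrp p n\<^esub>"
      by (auto simp: Mgrp_mult Mgrp_one x1_def y1_def mod_add_left_eq fun_eq_iff)
  qed
  fix g' assume g': "g' \<in> carrier (Mgrp p n)"
  obtain x' y' z' where [simp]: "g' = (x', y', z')" by (cases g')
  show "g \<otimes>\<^bsub>Mgrp p n\<^esub> g' \<in> carrier (Mgrp p n)"
    using p by (auto simp: Mgrp_mult Mgrp_carrier mems)
  fix g'' assume g'': "g'' \<in> carrier (Mgrp p n)"
  obtain x'' y'' z'' where [simp]: "g'' = (x'', y'', z'')" by (cases g'')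
  let ?m = "int p"
  define a where "a = (\<lambda>i\<in>{1..n}. (x i + x' i) mod ?m)"
  define b where "b = (\<lambda>i\<in>{1..n}. (y i + y' i) mod ?m)"
  define c where "c = (\<lambda>i\<in>{1..n}. (y' i + y'' i) mod ?m)"
  have ab: "dotp n a y'' mod ?m = (dotp n x y'' + dotp n x' y'') mod ?m"
    unfolding a_def by (rule dotp_mod_left)
  have xc: "dotp n x c mod ?m = (dotp n x y' + dotp n x y'') mod ?m"
    unfolding c_def by (subst (1 2 3) dotp_commute) (rule dotp_mod_left)
  have cc: "carry p n y y' + carry p n b y'' = carry p n y' y'' + carry p n y c"
    unfolding b_def c_def by (rule carry_cocycle[OF p(1)])
  have aux1: "(t mod ?m + u + v + w) mod ?m = (t + u + w + v mod ?m) mod ?m" for t u v w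
  proof -
    have "(t mod ?m + u + v + w) mod ?m = (t + (u + v + w)) mod ?m"
      by (simp only: add.assoc mod_add_left_eq)
    also have "\<dots> = (t + u + w + v) mod ?m" by (simp add: add_ac)
    finally show ?thesis by (simp only: mod_add_right_eq)
  qed
  have "((z + z' + dotp n x y' + carry p n y y') mod ?m + z'' + dotp n a y'' + carry p n b y'') mod ?m
      = (z + z' + dotp n x y' + carry p n y y' + z'' + carry p n b y'' + dotp n a y'' mod ?m) mod ?m"
    by (rule aux1)
  also have "\<dots> = (z + z' + dotp n x y' + z'' + (carry p n y y' + carry p n b y'')
                   + (dotp n x y'' + dotp n x' y'')) mod ?m"
    unfolding ab by (simp only: mod_add_right_eq) (simp add: add_ac)
  also have "\<dots> = (z' + z'' + dotp n x' y'' + carry p n y' y'' + z + carry p n y c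
                   + (dotp n x y' + dotp n x y'')) mod ?m"
    unfolding cc by (simp add: add_ac)
  also have "\<dots> = (z' + z'' + dotp n x' y'' + carry p n y' y'' + z + carry p n y c
                   + dotp n x c mod ?m) mod ?m"
    unfolding xc by (simp only: mod_add_right_eq)
  also have "\<dots> = ((z' + z'' + dotp n x' y'' + carry p n y' y'') mod ?m + z
                   + dotp n x c + carry p n y c) mod ?m"
    by (rule aux1[symmetric])
  also have "\<dots> = (z + (z' + z'' + dotp n x' y'' + carry p n y' y'') mod ?m
                   + dotp n x c + carry p n y c) mod ?m"
    by (simp only: add.commute)
  finally have third: "((z + z' + dotp n x y' + carry p n y y') mod ?m + z'' + dotp n a y'' + carry p n b y'') mod ?m
      = (z + (z' + z'' + dotp n x' y'' + carry p n y' y'') mod ?m + dotp n x c + carry p n y c) mod ?m" .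
  show "g \<otimes>\<^bsub>Mgrp p n\<^esub> g' \<otimes>\<^bsub>Mgrp p n\<^esub> g'' = g \<otimes>\<^bsub>Mgrp p n\<^esub> (g' \<otimes>\<^bsub>Mgrp p n\<^esub> g'')"
    using third unfolding a_def b_def c_def
    by (auto simp: Mgrp_mult fun_eq_iff mod_simps add_ac)
qed

lemma dotp_zero: "dotp n (\<lambda>i\<in>{1..n}. 0) y = 0" "dotp n y (\<lambda>i\<in>{1..n}. 0) = 0"
  by (simp_all add: dotp_def)

lemma carry_commute: "carry p n y y' = carry p n y' y"
  by (simp add: carry_def add.commute)

lemma carry_zero:
  assumes "y \<in> {1..n} \<rightarrow>\<^sub>E Fp p"
  shows "carry p n y (\<lambda>i\<in>{1..n}. 0) = 0"
  unfolding carry_div using assms by (intro sum.neutral) (auto simp: Fp_iff PiE_iff)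

lemma group_center_Mgrp:
  assumes "prime p"
  shows "group_center (Mgrp p n) = Mcenter p n"
proof
  have p: "p > 1" using assms prime_gt_1_nat by auto
  let ?m = "int p"
  let ?o = "\<lambda>i\<in>{1..n}. 0 :: int"
  have o: "?o \<in> {1..n} \<rightarrow>\<^sub>E Fp p" using p by (auto simp: Fp_iff)
  have z0: "0 \<in> Fp p" using p by (auto simp: Fp_iff)
  show "Mcenter p n \<subseteq> group_center (Mgrp p n)"
    using o by (auto simp: Mcenter_def group_center_def Mgrp_carrier Mgrp_mult
        dotp_zero[simplified] carry_commute fun_eq_iff add_ac)
  show "group_center (Mgrp p n) \<subseteq> Mcenter p n"
  proof
    fix g assume g: "g \<in> group_center (Mgrp p n)"
    obtain x y z where [simp]: "g = (x, y, z)" by (cases g)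
    have xyz: "x \<in> {1..n} \<rightarrow>\<^sub>E Fp p" "y \<in> {1..n} \<rightarrow>\<^sub>E Fp p" "z \<in> Fp p"
      using g by (auto simp: group_center_def Mgrp_carrier)
    have comm: "(x, y, z) \<otimes>\<^bsub>Mgrp p n\<^esub> h = h \<otimes>\<^bsub>Mgrp p n\<^esub> (x, y, z)" if "h \<in> carrier (Mgrp p n)" for h
      using g that by (auto simp: group_center_def)
    have xy0: "x i = 0 \<and> y i = 0" if i: "i \<in> {1..n}" for i
    proof -
      define e where "e = (\<lambda>j\<in>{1..n}. if j = i then 1 else 0 :: int)"
      have e: "e \<in> {1..n} \<rightarrow>\<^sub>E Fp p" using p by (auto simp: Fp_iff e_def)
      have de: "dotp n e u = u i" for u
      proof -
        have "dotp n e u = (\<Sum>j=1..n. if j = i then u j else 0)"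
          unfolding dotp_def e_def by (intro sum.cong) auto
        then show ?thesis using i by simp
      qed
      have "(z + y i) mod ?m = z mod ?m"
        using comm[of "(e, ?o, 0)"] e o z0 carry_zero[OF xyz(2)] carry_commute[of p n ?o y]
        by (simp add: Mgrp_carrier Mgrp_mult dotp_zero[simplified] de)
      then have "?m dvd y i"
        by (metis add_diff_cancel_left' mod_eq_dvd_iff)
      moreover have "(z + x i + carry p n y e) mod ?m = (z + carry p n y e) mod ?m"
        using comm[of "(?o, e, 0)"] e o z0 carry_commute[of p n y e]
        by (simp add: Mgrp_carrier Mgrp_mult dotp_zero[simplified] de dotp_commute[of n x e])
      then have "?m dvd x i"
        by (simp add: mod_eq_dvd_iff)
      ultimately show ?thesis
        using xyz i by (auto simp: Fp_iff PiE_iff zdvd_not_zless dest!: zdvd_imp_le bspec[of _ _ i] intro: ccontr)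
    qed
    have "x = ?o" "y = ?o"
      using xy0 xyz by (auto simp: fun_eq_iff PiE_iff extensional_def)
    then show "g \<in> Mcenter p n"
      using xyz by (auto simp: Mcenter_def)
  qed
qed

lemma subgroup_Mcenter:
  assumes "prime p"
  shows "subgroup (Mcenter p n) (Mgrp p n)"
proof -
  interpret group "Mgrp p n" by (rule group_Mgrp[OF assms])
  have "subgroup (group_center (Mgrp p n)) (Mgrp p n)"
  proof (rule subgroupI)
    show "group_center (Mgrp p n) \<subseteq> carrier (Mgrp p n)" by (auto simp: group_center_def)
    have "\<one>\<^bsub>Mgrp p n\<^esub> \<in> group_center (Mgrp p n)"
      by (simp add: group_center_def)
    then show "group_center (Mgrp p n) \<noteq> {}" by blast
    fix a assume a: "a \<in> group_center (Mgrp p n)"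
    then have ac: "a \<in> carrier (Mgrp p n)" by (auto simp: group_center_def)
    have "inv\<^bsub>Mgrp p n\<^esub> a \<otimes>\<^bsub>Mgrp p n\<^esub> h = h \<otimes>\<^bsub>Mgrp p n\<^esub> inv\<^bsub>Mgrp p n\<^esub> a"
      if h: "h \<in> carrier (Mgrp p n)" for h
    proof -
      have "a \<otimes>\<^bsub>Mgrp p n\<^esub> h = h \<otimes>\<^bsub>Mgrp p n\<^esub> a" using a h by (auto simp: group_center_def)
      then show ?thesis using ac h
        by (metis inv_closed inv_solve_left inv_solve_right m_assoc m_closed)
    qed
    then show "inv\<^bsub>Mgrp p n\<^esub> a \<in> group_center (Mgrp p n)"
      using ac by (auto simp: group_center_def)
    fix b assume b: "b \<in> group_center (Mgrp p n)"
    then have bc: "b \<in> carrier (Mgrp p n)" by (auto simp: group_center_def)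
    have "a \<otimes>\<^bsub>Mgrp p n\<^esub> b \<otimes>\<^bsub>Mgrp p n\<^esub> h = h \<otimes>\<^bsub>Mgrp p n\<^esub> (a \<otimes>\<^bsub>Mgrp p n\<^esub> b)"
      if h: "h \<in> carrier (Mgrp p n)" for h
    proof -
      have "a \<otimes>\<^bsub>Mgrp p n\<^esub> h = h \<otimes>\<^bsub>Mgrp p n\<^esub> a" "b \<otimes>\<^bsub>Mgrp p n\<^esub> h = h \<otimes>\<^bsub>Mgrp p n\<^esub> b"
        using a b h by (auto simp: group_center_def)
      then show ?thesis using ac bc h by (metis m_assoc)
    qed
    then show "a \<otimes>\<^bsub>Mgrp p n\<^esub> b \<in> group_center (Mgrp p n)"
      using ac bc by (auto simp: group_center_def)
  qed
  then show ?thesis by (simp add: group_center_Mgrp[OF assms])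
qed

lemma Mcenter_nontrivial:
  assumes "prime p"
  shows "Mcenter p n \<noteq> {\<one>\<^bsub>Mgrp p n\<^esub>}"
proof -
  have "1 \<in> Fp p" using assms prime_gt_1_nat by (auto simp: Fp_iff)
  then have "(\<lambda>i\<in>{1..n}. 0, \<lambda>i\<in>{1..n}. 0, 1) \<in> Mcenter p n"
    unfolding Mcenter_def by blast
  then show ?thesis by (auto simp: Mgrp_one)
qed

lemma order_Mgrp: "order (Mgrp p n) = p ^ (2 * n + 1)"
  by (simp add: order_def Mgrp_def card_cartesian_product card_PiE residue_ring_def
      mult_2 power_add)

end

theory Submission
  imports Defs
begin

text \<open>Write \<open>B = X \<times> Y \<times> Z\<close>. The coset over \<open>(u, v)\<close> lies in \<open>B \<cdot> B\<close> as soon as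
  \<open>z + z' + \<langle>x, y'\<rangle> + f (v - y', y')\<close> takes every value, where \<open>z, z' \<in> Z\<close>, \<open>x \<in> X \<inter> (u - X)\<close> and
  \<open>y' \<in> Y \<inter> (v - Y)\<close>.

  If \<open>2|Z| > p\<close>, then \<open>Z + Z\<close> is everything and each of the at least \<open>|X||Y|\<close> pairs in
  \<open>(X + X) \<times> (Y + Y)\<close> is good. Otherwise fix \<open>z = z'\<close>. For distinct \<open>y', y''\<close> the values at \<open>y'\<close> and \<open>y''\<close>
  agree for at most \<open>p ^ (n - 1)\<close> of the \<open>p ^ n\<close> vectors \<open>x\<close>, whatever the cocycle \<open>f\<close> is, so a second
  moment estimate shows that \<open>(u, v)\<close> is good whenever \<open>|X \<inter> (u - X)| |Y \<inter> (v - Y)| > p ^ (n + 2)\<close>.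
  These products add up to \<open>(|X||Y|)\<^sup>2 \<ge> 2 p ^ (3n + 2)\<close> and each is at most \<open>|X||Y|\<close>, so at least
  \<open>|X||Y|/2 \<ge> |B|/p\<close> pairs are good.\<close>

text \<open>Otherwise the simplifier turns \<open>{1..n}\<close> into \<open>{Suc 0..n}\<close> and lemmas about vectors no longer match.\<close>
declare One_nat_def [simp del]

section \<open>Second moments of fibre sizes\<close>

lemma card_filter_eq_sum: "finite A \<Longrightarrow> card {x\<in>A. P x} = (\<Sum>x\<in>A. if P x then 1 else 0)"
  by (simp only: card_eq_sum sum.inter_filter)

lemma sum_card_fibres_squared:
  assumes "finite D" "finite W" "h ` D \<subseteq> W"
  shows "(\<Sum>w\<in>W. (card {y\<in>D. h y = w})\<^sup>2) = card {(y, y') \<in> D \<times> D. h y = h y'}"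
proof -
  have "{(y, y') \<in> D \<times> D. h y = h y'} = (\<Union>w\<in>W. {y\<in>D. h y = w} \<times> {y\<in>D. h y = w})"
    using assms(3) by auto
  also have "card \<dots> = (\<Sum>w\<in>W. card ({y\<in>D. h y = w} \<times> {y\<in>D. h y = w}))"
    using assms by (intro card_UN_disjoint) auto
  finally show ?thesis
    by (simp add: card_cartesian_product power2_eq_square)
qed

text \<open>Expanding the square leaves the sum of the squared fibre sizes, which counts colliding
  pairs, and the sum of the fibre sizes, which is \<open>card D\<close> because the fibres partition
  \<open>D\<close>.\<close>

lemma sum_fibres_variance:
  fixes q :: real
  assumes "finite D" "finite W" "h ` D \<subseteq> W" "q = card W" "q > 0"
  shows "(\<Sum>w\<in>W. (real (card {y\<in>D. h y = w}) - card D / q)\<^sup>2)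
           = card {(y, y') \<in> D \<times> D. h y = h y'} - (card D)\<^sup>2 / q"
proof -
  let ?r = "\<lambda>w. real (card {y\<in>D. h y = w})" and ?d = "real (card D)"
  have "D = (\<Union>w\<in>W. {y\<in>D. h y = w})"
    using assms(3) by auto
  then have "card D = (\<Sum>w\<in>W. card {y\<in>D. h y = w})"
    using card_UN_disjoint[of W "\<lambda>w. {y\<in>D. h y = w}"] assms(1,2) by auto
  then have r1: "(\<Sum>w\<in>W. ?r w) = ?d"
    by simp
  have r2: "(\<Sum>w\<in>W. (?r w)\<^sup>2) = card {(y, y') \<in> D \<times> D. h y = h y'}"
    unfolding sum_card_fibres_squared[OF assms(1-3), symmetric] by simp
  have "(\<Sum>w\<in>W. (?r w - ?d / q)\<^sup>2) = (\<Sum>w\<in>W. (?r w)\<^sup>2 - 2 * ?d / q * ?r w + (?d / q)\<^sup>2)"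
    by (intro sum.cong) (auto simp: power2_diff)
  also have "\<dots> = (\<Sum>w\<in>W. (?r w)\<^sup>2) - 2 * ?d / q * (\<Sum>w\<in>W. ?r w) + q * (?d / q)\<^sup>2"
    by (simp add: sum.distrib sum_subtractf assms(4) sum_distrib_left)
  also have "\<dots> = (\<Sum>w\<in>W. (?r w)\<^sup>2) - ?d\<^sup>2 / q"
    unfolding r1 using assms(5) by (simp add: field_simps power2_eq_square)
  finally show ?thesis
    unfolding r2 by simp
qed

text \<open>For each \<open>x\<close> take the variance over \<open>W\<close> of the fibre sizes of
  \<open>\<phi> x\<close> on \<open>D\<close>. If \<open>x\<close> lies in \<open>A\<close>, the
  empty fibre over \<open>w\<close> alone contributes \<open>(d / q)^2\<close>. Summed over all of
  \<open>V\<close>, the collision hypothesis keeps the total variance below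
  \<open>d * card V\<close>. Comparing the two bounds and cancelling one factor \<open>d\<close>
  gives the claim.\<close>

lemma missed_value_bound:
  fixes \<phi> :: "'a \<Rightarrow> 'b \<Rightarrow> 'c"
  assumes fin: "finite V" "finite D" "finite W"
    and maps: "\<And>x y. x \<in> V \<Longrightarrow> y \<in> D \<Longrightarrow> \<phi> x y \<in> W"
    and coll: "\<And>y y'. y \<in> D \<Longrightarrow> y' \<in> D \<Longrightarrow> y \<noteq> y' \<Longrightarrow>
                 card W * card {x\<in>V. \<phi> x y = \<phi> x y'} \<le> card V"
    and A: "A \<subseteq> V" and w: "w \<in> W" and missed: "\<And>x y. x \<in> A \<Longrightarrow> y \<in> D \<Longrightarrow> \<phi> x y \<noteq> w"
  shows "card A * card D \<le> (card W)\<^sup>2 * card V"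
proof (cases "D = {}")
  case False
  define q where "q = real (card W)"
  define d where "d = real (card D)"
  define C where "C x = {(y, y') \<in> D \<times> D. \<phi> x y = \<phi> x y'}" for x
  have q: "q > 0" using w fin by (auto simp: q_def card_gt_0_iff)
  have d: "d > 0" using False fin by (auto simp: d_def card_gt_0_iff)
  have var: "(\<Sum>w\<in>W. (real (card {y\<in>D. \<phi> x y = w}) - d / q)\<^sup>2) = card (C x) - d\<^sup>2 / q"
    if "x \<in> V" for x
    unfolding C_def d_def using sum_fibres_variance[OF fin(2,3) _ q_def q, of "\<phi> x"] maps[OF that] by auto
  have nonneg: "real (card (C x)) - d\<^sup>2 / q \<ge> 0" if "x \<in> V" for x
    unfolding var[OF that, symmetric] by (simp add: sum_nonneg)
  have lower: "real (card (C x)) - d\<^sup>2 / q \<ge> d\<^sup>2 / q\<^sup>2" if x: "x \<in> A" for x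
  proof -
    have "{y\<in>D. \<phi> x y = w} = {}" using missed[OF x] by auto
    then have "(d / q)\<^sup>2 = (real (card {y\<in>D. \<phi> x y = w}) - d / q)\<^sup>2"
      by (simp only: card.empty of_nat_0 diff_0 power2_minus)
    also have "\<dots> \<le> (\<Sum>w\<in>W. (real (card {y\<in>D. \<phi> x y = w}) - d / q)\<^sup>2)"
      by (rule member_le_sum) (use w fin in auto)
    finally show ?thesis
      using var x A by (auto simp: power_divide)
  qed
  have "(\<Sum>x\<in>V. card (C x)) = (\<Sum>x\<in>V. \<Sum>y\<in>D. \<Sum>y'\<in>D. if \<phi> x y = \<phi> x y' then 1 else 0)"
  proof (rule sum.cong[OF refl])
    fix x
    have "C x = {q \<in> D \<times> D. \<phi> x (fst q) = \<phi> x (snd q)}"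
      by (auto simp: C_def)
    then show "card (C x) = (\<Sum>y\<in>D. \<Sum>y'\<in>D. if \<phi> x y = \<phi> x y' then 1 else 0)"
      using fin by (simp add: card_filter_eq_sum sum.cartesian_product case_prod_beta)
  qed
  also have "\<dots> = (\<Sum>y\<in>D. \<Sum>x\<in>V. \<Sum>y'\<in>D. if \<phi> x y = \<phi> x y' then 1 else 0)"
    by (rule sum.swap)
  also have "\<dots> = (\<Sum>y\<in>D. \<Sum>y'\<in>D. \<Sum>x\<in>V. if \<phi> x y = \<phi> x y' then 1 else 0)"
    by (intro sum.cong refl sum.swap)
  also have "\<dots> = (\<Sum>y\<in>D. \<Sum>y'\<in>D. card {x\<in>V. \<phi> x y = \<phi> x y'})"
    using fin by (simp only: card_filter_eq_sum)
  finally have swap: "(\<Sum>x\<in>V. card (C x)) = (\<Sum>y\<in>D. \<Sum>y'\<in>D. card {x\<in>V. \<phi> x y = \<phi> x y'})" .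
  have "(\<Sum>y'\<in>D. real (card {x\<in>V. \<phi> x y = \<phi> x y'})) \<le> card V + d * (card V / q)" if y: "y \<in> D" for y
  proof -
    \<comment> \<open>The diagonal term \<open>y' = y\<close> costs the trivial
      \<open>card V\<close>; each other term costs at most \<open>card V / q\<close> by
      \<open>coll\<close>.\<close>
    have "(\<Sum>y'\<in>D. real (card {x\<in>V. \<phi> x y = \<phi> x y'}))
            \<le> (\<Sum>y'\<in>D. (if y' = y then real (card V) else 0) + card V / q)"
    proof (rule sum_mono)
      fix y' assume y': "y' \<in> D"
      show "real (card {x\<in>V. \<phi> x y = \<phi> x y'}) \<le> (if y' = y then real (card V) else 0) + card V / q"
      proof (cases "y' = y")
        case False
        have "real (card W * card {x\<in>V. \<phi> x y = \<phi> x y'}) \<le> real (card V)"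
          using coll[OF y y'] False by (simp only: of_nat_le_iff) auto
        then show ?thesis using False q by (simp add: q_def field_simps)
      qed (use q in simp)
    qed
    also have "\<dots> = card V + d * (card V / q)"
      using y fin by (simp add: sum.distrib d_def)
    finally show ?thesis .
  qed
  then have "(\<Sum>y\<in>D. \<Sum>y'\<in>D. real (card {x\<in>V. \<phi> x y = \<phi> x y'})) \<le> (\<Sum>y\<in>D. card V + d * (card V / q))"
    by (rule sum_mono)
  also have "\<dots> = d * card V + d\<^sup>2 * card V / q"
    by (simp add: d_def algebra_simps power2_eq_square)
  also have "(\<Sum>y\<in>D. \<Sum>y'\<in>D. real (card {x\<in>V. \<phi> x y = \<phi> x y'})) = (\<Sum>x\<in>V. real (card (C x)))"
    using swap by (simp flip: of_nat_sum)
  \<comment> \<open>The off-diagonal part \<open>d^2 * card V / q\<close> cancels exactly against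
    the subtracted means, so only the diagonal survives.\<close>
  finally have upper: "(\<Sum>x\<in>V. real (card (C x)) - d\<^sup>2 / q) \<le> d * card V"
    by (simp add: sum_subtractf mult.commute)
  have "card A * (d\<^sup>2 / q\<^sup>2) \<le> (\<Sum>x\<in>A. real (card (C x)) - d\<^sup>2 / q)"
    using sum_mono[OF lower] by simp
  \<comment> \<open>Enlarging \<open>A\<close> to \<open>V\<close> is harmless since each summand is
    a variance, hence nonnegative.\<close>
  also have "\<dots> \<le> (\<Sum>x\<in>V. real (card (C x)) - d\<^sup>2 / q)"
    using A fin nonneg by (intro sum_mono2) auto
  also note upper
  finally have "d * (card A * d) \<le> d * (q\<^sup>2 * card V)"
    using q by (simp add: field_simps power2_eq_square)
  then have "card A * d \<le> q\<^sup>2 * card V"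
    using d by simp
  then have "real (card A * card D) \<le> real ((card W)\<^sup>2 * card V)"
    by (simp add: d_def q_def)
  then show ?thesis by (simp only: of_nat_le_iff)
qed simp

section \<open>Vectors over the prime field\<close>

abbreviation Fvec :: "nat \<Rightarrow> nat \<Rightarrow> (nat \<Rightarrow> int) set" where
  "Fvec p n \<equiv> {1..n} \<rightarrow>\<^sub>E Fp p"

definition vadd :: "nat \<Rightarrow> nat \<Rightarrow> (nat \<Rightarrow> int) \<Rightarrow> (nat \<Rightarrow> int) \<Rightarrow> nat \<Rightarrow> int" where
  "vadd p n x y = (\<lambda>i\<in>{1..n}. (x i + y i) mod int p)"

definition vsub :: "nat \<Rightarrow> nat \<Rightarrow> (nat \<Rightarrow> int) \<Rightarrow> (nat \<Rightarrow> int) \<Rightarrow> nat \<Rightarrow> int" where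
  "vsub p n x y = (\<lambda>i\<in>{1..n}. (x i - y i) mod int p)"

lemma finite_Fp: "finite (Fp p)"
  by (simp add: residue_ring_def)

lemma card_Fp: "card (Fp p) = p"
  by (simp add: residue_ring_def)

lemma finite_Fvec: "finite (Fvec p n)"
  by (intro finite_PiE) (simp_all add: finite_Fp)

lemma card_Fvec: "card (Fvec p n) = p ^ n"
  by (simp add: card_PiE card_Fp)

lemma mod_in_Fp: "p > 0 \<Longrightarrow> a mod int p \<in> Fp p"
  by (simp add: Fp_iff)

lemma Fp_eq_iff:
  assumes "a \<in> Fp p" "b \<in> Fp p"
  shows "a = b \<longleftrightarrow> int p dvd a - b"
  using assms by (metis Fp_iff mod_eq_dvd_iff mod_pos_pos_trivial)

lemma vadd_in_Fvec: "p > 0 \<Longrightarrow> vadd p n x y \<in> Fvec p n"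
  by (auto simp: vadd_def Fp_iff)

lemma vsub_in_Fvec: "p > 0 \<Longrightarrow> vsub p n x y \<in> Fvec p n"
  by (auto simp: vsub_def Fp_iff)

lemma Fvec_restrict_mod: "x \<in> Fvec p n \<Longrightarrow> (\<lambda>i\<in>{1..n}. x i mod int p) = x"
  by (auto simp: fun_eq_iff PiE_iff extensional_def Fp_iff)

lemma vsub_vadd: "y \<in> Fvec p n \<Longrightarrow> vsub p n (vadd p n y x) x = y"
  using Fvec_restrict_mod[where x = y and p = p and n = n]
  by (simp add: vsub_def vadd_def mod_simps cong: restrict_cong)

lemma vadd_vsub: "u \<in> Fvec p n \<Longrightarrow> vadd p n (vsub p n u x) x = u"
  using Fvec_restrict_mod[where x = u and p = p and n = n]
  by (simp add: vsub_def vadd_def mod_simps cong: restrict_cong)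

lemma vadd_commute: "vadd p n x y = vadd p n y x"
  by (simp add: vadd_def add.commute)

lemma inj_on_vadd: "inj_on (\<lambda>y. vadd p n y x) (Fvec p n)"
  by (rule inj_on_inverseI[where g = "\<lambda>u. vsub p n u x"]) (rule vsub_vadd)

section \<open>Values of the dot product with an arbitrary shift\<close>

text \<open>At a coordinate \<open>i\<close> where \<open>y\<close> and \<open>y'\<close> differ,
  the equation determines \<open>x i\<close> from the other coordinates, so dropping coordinate
  \<open>i\<close> is injective on the solutions. The constants \<open>c\<close> and
  \<open>c'\<close> are unrelated, which leaves room for any function of \<open>y\<close>, in
  particular the cocycle.\<close>

lemma card_affine_collisions:
  assumes p: "prime p" and y: "y \<in> Fvec p n" "y' \<in> Fvec p n" "y \<noteq> y'"
  shows "p * card {x \<in> Fvec p n. (dotp n x y + c) mod int p = (dotp n x y' + c') mod int p} \<le> p ^ n"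
    (is "p * card ?S \<le> _")
proof -
  obtain i where i: "i \<in> {1..n}" "y i \<noteq> y' i"
    using y PiE_ext by metis
  have pi: "prime (int p)" using p by simp
  let ?I = "{1..n} - {i}"
  have "inj_on (\<lambda>x. restrict x ?I) ?S"
  proof (rule inj_onI)
    fix x x' assume x: "x \<in> ?S" and x': "x' \<in> ?S" and eq: "restrict x ?I = restrict x' ?I"
    have off: "x j = x' j" if "j \<in> ?I" for j
      using fun_cong[OF eq, of j] that by simp
    have split: "dotp n a b = a i * b i + (\<Sum>j\<in>?I. a j * b j)" for a b
      unfolding dotp_def using i by (simp add: sum.remove)
    have same: "(\<Sum>j\<in>?I. x j * b j) = (\<Sum>j\<in>?I. x' j * b j)" for b
      using off by (intro sum.cong) auto
    have "int p dvd (dotp n x y + c) - (dotp n x y' + c')" "int p dvd (dotp n x' y + c) - (dotp n x' y' + c')"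
      using x x' by (auto simp: mod_eq_dvd_iff)
    \<comment> \<open>Subtracting the two congruences removes \<open>c\<close>, \<open>c'\<close>
      and every coordinate except \<open>i\<close>.\<close>
    then have "int p dvd ((dotp n x y + c) - (dotp n x y' + c')) - ((dotp n x' y + c) - (dotp n x' y' + c'))"
      by (rule dvd_diff)
    also have "\<dots> = (x i - x' i) * (y i - y' i)"
      unfolding split same by (simp add: algebra_simps)
    finally have "int p dvd x i - x' i \<or> int p dvd y i - y' i"
      using pi by (simp add: prime_dvd_mult_iff)
    moreover have "\<not> int p dvd y i - y' i"
      using Fp_eq_iff[of "y i" p "y' i"] y i by (auto simp: PiE_iff)
    ultimately have "x i = x' i"
      using Fp_eq_iff[of "x i" p "x' i"] x x' i by (auto simp: PiE_iff)
    then show "x = x'"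
      using x x' off by (intro PiE_ext[where k = "{1..n}" and s = "\<lambda>_. Fp p"]) auto
  qed
  moreover have "(\<lambda>x. restrict x ?I) ` ?S \<subseteq> ?I \<rightarrow>\<^sub>E Fp p"
    by (rule image_subsetI) (auto simp: restrict_PiE_iff intro: PiE_mem)
  ultimately have "card ?S \<le> card (?I \<rightarrow>\<^sub>E Fp p)"
    by (rule card_inj_on_le) (intro finite_PiE; simp add: finite_Fp)
  also have "\<dots> = p ^ (n - 1)"
    using i by (simp add: card_PiE card_Fp)
  finally have "p * card ?S \<le> p * p ^ (n - 1)"
    by simp
  also have "\<dots> = p ^ n"
    using i by (cases n) auto
  finally show ?thesis .
qed

text \<open>A missed value \<open>w\<close> would contradict \<open>missed_value_bound\<close> with
  \<open>V\<close> the whole vector space and \<open>W\<close> the field; the threshold is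
  \<open>p^2 * p^n\<close>.\<close>

lemma affine_form_surjective:
  assumes p: "prime p" and "A \<subseteq> Fvec p n" "D \<subseteq> Fvec p n"
    and big: "card A * card D > p ^ (n + 2)" and w: "w \<in> Fp p"
  shows "\<exists>x\<in>A. \<exists>y\<in>D. (dotp n x y + g y) mod int p = w"
proof (rule ccontr)
  assume "\<not> ?thesis"
  then have "card A * card D \<le> (card (Fp p))\<^sup>2 * card (Fvec p n)"
    using assms(2,3) w prime_gt_0_nat[OF p]
    by (intro missed_value_bound[where \<phi> = "\<lambda>x y. (dotp n x y + g y) mod int p" and w = w])
      (auto simp: finite_Fvec finite_Fp finite_subset[OF _ finite_Fvec] card_Fvec card_Fp mod_in_Fp
        intro!: card_affine_collisions[OF p])
  then show False
    using big by (simp add: card_Fp card_Fvec power_add power2_eq_square mult_ac)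
qed

section \<open>Popular sums\<close>

text \<open>This is the intersection of \<open>X\<close> with \<open>u - X\<close>; its size is the
  number of representations of \<open>u\<close> as an ordered sum of two elements of
  \<open>X\<close>.\<close>

definition symm :: "nat \<Rightarrow> nat \<Rightarrow> (nat \<Rightarrow> int) set \<Rightarrow> (nat \<Rightarrow> int) \<Rightarrow> (nat \<Rightarrow> int) set" where
  "symm p n X u = {x \<in> X. vsub p n u x \<in> X}"

text \<open>Each ordered pair of elements of \<open>X\<close> is counted exactly once, at its sum
  \<open>u\<close>.\<close>

lemma sum_card_symm:
  assumes p: "p > 0" and X: "X \<subseteq> Fvec p n"
  shows "(\<Sum>u\<in>Fvec p n. card (symm p n X u)) = (card X)\<^sup>2"
proof -
  have fin: "finite X" using X finite_Fvec finite_subset by blast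
  have "(\<Sum>u\<in>Fvec p n. card (symm p n X u)) = (\<Sum>u\<in>Fvec p n. \<Sum>x\<in>X. if vsub p n u x \<in> X then 1 else 0)"
    unfolding symm_def using fin by (simp only: card_filter_eq_sum)
  also have "\<dots> = (\<Sum>x\<in>X. \<Sum>u\<in>Fvec p n. if vsub p n u x \<in> X then 1 else 0)"
    by (rule sum.swap)
  also have "\<dots> = (\<Sum>x\<in>X. card {u\<in>Fvec p n. vsub p n u x \<in> X})"
    by (simp only: card_filter_eq_sum finite_Fvec)
  also have "\<dots> = (\<Sum>x\<in>X. card X)"
  proof (intro sum.cong refl)
    fix x
    have "{u\<in>Fvec p n. vsub p n u x \<in> X} = (\<lambda>y. vadd p n y x) ` X"
    proof (intro subset_antisym subsetI)
      fix u assume "u \<in> {u\<in>Fvec p n. vsub p n u x \<in> X}"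
      then show "u \<in> (\<lambda>y. vadd p n y x) ` X"
        by (metis (mono_tags, lifting) image_eqI mem_Collect_eq vadd_vsub)
    next
      fix u assume "u \<in> (\<lambda>y. vadd p n y x) ` X"
      then obtain y where y: "y \<in> X" "u = vadd p n y x" by blast
      then have "vsub p n u x = y" using X vsub_vadd by blast
      then show "u \<in> {u\<in>Fvec p n. vsub p n u x \<in> X}"
        using y vadd_in_Fvec[OF p] by simp
    qed
    then show "card {u\<in>Fvec p n. vsub p n u x \<in> X} = card X"
      using card_image inj_on_subset[OF inj_on_vadd X] by metis
  qed
  finally show ?thesis by (simp add: power2_eq_square)
qed

text \<open>The products of representation counts sum to \<open>(card X * card Y)^2\<close>.
  Charging \<open>K\<close> to every pair accounts for at most half of this, so the popular pairs
  carry the other half, and each of them carries at most \<open>card X * card Y\<close>.\<close>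

lemma card_popular_pairs:
  assumes p: "p > 0" and X: "X \<subseteq> Fvec p n" "X \<noteq> {}" and Y: "Y \<subseteq> Fvec p n" "Y \<noteq> {}"
    and big: "(card X * card Y)\<^sup>2 \<ge> 2 * p ^ (2 * n) * K"
  shows "card X * card Y \<le>
     2 * card {(u, v) \<in> Fvec p n \<times> Fvec p n. card (symm p n X u) * card (symm p n Y v) > K}"
    (is "_ \<le> 2 * card ?G")
proof -
  let ?V = "Fvec p n \<times> Fvec p n" and ?m = "card X * card Y"
  have fin: "finite X" "finite Y" using X Y finite_Fvec finite_subset by blast+
  then have m: "?m > 0" using X Y by (simp add: card_gt_0_iff)
  have V: "finite ?V" by (simp add: finite_Fvec)
  have "card (symm p n X u) * card (symm p n Y v) \<le> ?m" for u v
    using fin by (intro mult_mono card_mono) (auto simp: symm_def)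
  then have bound: "card (symm p n X u) * card (symm p n Y v) \<le> (if (u, v) \<in> ?G then ?m else 0) + K"
    if "(u, v) \<in> ?V" for u v
    using that by (auto simp: not_less intro: trans_le_add1)
  have "?m\<^sup>2 = (\<Sum>u\<in>Fvec p n. card (symm p n X u)) * (\<Sum>v\<in>Fvec p n. card (symm p n Y v))"
    by (simp only: sum_card_symm[OF p] X Y power_mult_distrib)
  also have "\<dots> = (\<Sum>(u, v)\<in>?V. card (symm p n X u) * card (symm p n Y v))"
    by (simp only: sum_product sum.cartesian_product)
  also have "\<dots> \<le> (\<Sum>g\<in>?V. (if g \<in> ?G then ?m else 0) + K)"
    using bound by (intro sum_mono) (simp only: split_paired_all prod.case)
  also have "\<dots> = (\<Sum>g\<in>?V. if g \<in> ?G then ?m else 0) + card ?V * K"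
    by (simp add: sum.distrib)
  also have "(\<Sum>g\<in>?V. if g \<in> ?G then ?m else 0) = (\<Sum>g\<in>?V \<inter> ?G. ?m)"
    using V by (rule sum.inter_restrict[symmetric])
  also have "?V \<inter> ?G = ?G" by auto
  also have "card ?V = p ^ (2 * n)"
    by (simp add: card_cartesian_product card_Fvec mult_2 power_add)
  finally have "?m\<^sup>2 \<le> card ?G * ?m + p ^ (2 * n) * K"
    by simp
  then have "?m * ?m \<le> (2 * card ?G) * ?m"
    using big unfolding power2_eq_square by linarith
  then show ?thesis using m by (simp only: mult_le_cancel2)
qed

section \<open>Cosets of the center as fibres\<close>

text \<open>Multiplying \<open>(u, v, 0)\<close> by a central element changes only the last
  coordinate, since the dot product and the carry with a zero vector vanish.\<close>

lemma full_fibre_in_rcosets: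
  assumes "prime p" "u \<in> Fvec p n" "v \<in> Fvec p n"
  shows "{u} \<times> {v} \<times> Fp p \<in> rcosets\<^bsub>Mgrp p n\<^esub> (Mcenter p n)"
proof -
  have p: "p > 0" using assms(1) prime_gt_0_nat by auto
  let ?o = "\<lambda>i\<in>{1..n}. 0 :: int"
  have "carry p n ?o v = 0"
    using carry_zero[OF assms(3)] carry_commute by metis
  then have "(?o, ?o, z) \<otimes>\<^bsub>Mgrp p n\<^esub> (u, v, 0) = (u, v, z)" if "z \<in> Fp p" for z
    using that Fvec_restrict_mod[OF assms(2)] Fvec_restrict_mod[OF assms(3)]
    by (simp add: Mgrp_mult dotp_zero[simplified] Fp_iff cong: restrict_cong)
  then have "Mcenter p n #>\<^bsub>Mgrp p n\<^esub> (u, v, 0) = {u} \<times> {v} \<times> Fp p"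
    unfolding r_coset_def Mcenter_def by force
  moreover have "(u, v, 0) \<in> carrier (Mgrp p n)"
    using assms p by (simp add: Mgrp_carrier Fp_iff)
  ultimately show ?thesis
    unfolding RCOSETS_def by blast
qed

lemma card_rcosets_ge:
  assumes p: "prime p" and G: "G \<subseteq> Fvec p n \<times> Fvec p n"
    and full: "\<And>u v. (u, v) \<in> G \<Longrightarrow> {u} \<times> {v} \<times> Fp p \<subseteq> S"
  shows "card G \<le> card {C \<in> rcosets\<^bsub>Mgrp p n\<^esub> (Mcenter p n). C \<subseteq> S}"
proof (rule card_inj_on_le)
  have ne: "0 \<in> Fp p" using prime_gt_0_nat[OF p] by (simp add: Fp_iff)
  show "inj_on (\<lambda>(u, v). {u} \<times> {v} \<times> Fp p) G"
    using ne by (auto simp: inj_on_def times_eq_iff)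
  show "(\<lambda>(u, v). {u} \<times> {v} \<times> Fp p) ` G \<subseteq> {C \<in> rcosets\<^bsub>Mgrp p n\<^esub> (Mcenter p n). C \<subseteq> S}"
  proof clarify
    fix u v assume "(u, v) \<in> G"
    then show "{u} \<times> {v} \<times> Fp p \<in> rcosets\<^bsub>Mgrp p n\<^esub> (Mcenter p n) \<and> {u} \<times> {v} \<times> Fp p \<subseteq> S"
      using G full by (intro conjI full_fibre_in_rcosets[OF p]) blast+
  qed
  \<comment> \<open>Finiteness of the target is required because \<open>card\<close> of an infinite
    set is 0.\<close>
  have "finite (carrier (Mgrp p n))"
    by (simp add: Mgrp_def finite_Fvec finite_Fp)
  moreover have "rcosets\<^bsub>Mgrp p n\<^esub> (Mcenter p n) \<subseteq> Pow (carrier (Mgrp p n))"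
    using group.rcosets_subset_PowG[OF group_Mgrp subgroup_Mcenter] p by blast
  ultimately show "finite {C \<in> rcosets\<^bsub>Mgrp p n\<^esub> (Mcenter p n). C \<subseteq> S}"
    by (intro finite_Collect_conjI disjI1) (simp add: finite_subset)
qed

section \<open>Full fibres inside the product set\<close>

lemma mult_in_set_mult:
  assumes "x \<in> X" "x' \<in> X" "y \<in> Y" "y' \<in> Y" "z \<in> Z" "z' \<in> Z"
  shows "(vadd p n x x', vadd p n y y', (z + z' + dotp n x y' + carry p n y y') mod int p)
           \<in> (X \<times> Y \<times> Z) <#>\<^bsub>Mgrp p n\<^esub> (X \<times> Y \<times> Z)"
proof -
  have "(x, y, z) \<otimes>\<^bsub>Mgrp p n\<^esub> (x', y', z') \<in> (X \<times> Y \<times> Z) <#>\<^bsub>Mgrp p n\<^esub> (X \<times> Y \<times> Z)"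
    using assms unfolding set_mult_def by blast
  then show ?thesis by (simp add: Mgrp_mult vadd_def)
qed

text \<open>Pigeonhole: \<open>Z\<close> and its reflection \<open>w - c - Z\<close> each fill more
  than half of the field, so they meet.\<close>

lemma Fp_sumset_full:
  assumes p: "p > 0" and Z: "Z \<subseteq> Fp p" "2 * card Z > p" and w: "w \<in> Fp p"
  shows "\<exists>z\<in>Z. \<exists>z'\<in>Z. (z + z' + c) mod int p = w"
proof -
  let ?h = "\<lambda>z. (w - c - z) mod int p"
  have "inj_on ?h Z"
  proof (rule inj_onI)
    fix a b assume "a \<in> Z" "b \<in> Z" "?h a = ?h b"
    then have "int p dvd b - a" by (simp add: mod_eq_dvd_iff)
    then show "a = b" using Fp_eq_iff[of b p a] Z \<open>a \<in> Z\<close> \<open>b \<in> Z\<close> by auto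
  qed
  then have card: "card (?h ` Z) = card Z" by (rule card_image)
  have "Z \<inter> ?h ` Z \<noteq> {}"
  proof
    assume "Z \<inter> ?h ` Z = {}"
    then have "card (Z \<union> ?h ` Z) = 2 * card Z"
      using card finite_subset[OF Z(1) finite_Fp] by (simp add: card_Un_disjoint)
    moreover have "card (Z \<union> ?h ` Z) \<le> card (Fp p)"
      using Z p by (intro card_mono finite_Fp) (auto simp: Fp_iff)
    ultimately show False using Z by (simp add: card_Fp)
  qed
  then obtain z z' where z: "z \<in> Z" "z' \<in> Z" "z = ?h z'" by auto
  have "(z + z' + c) mod int p = ((w - c - z') + (z' + c)) mod int p"
    using z(3) by (simp only: add.assoc mod_add_left_eq)
  also have "\<dots> = w" using w by (simp add: Fp_iff)
  finally show ?thesis using z by blast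
qed

lemma popular_fibre_full:
  assumes p: "prime p" and XY: "X \<subseteq> Fvec p n" "Y \<subseteq> Fvec p n" and z: "z \<in> Z"
    and uv: "u \<in> Fvec p n" "v \<in> Fvec p n"
    and big: "card (symm p n X u) * card (symm p n Y v) > p ^ (n + 2)"
  shows "{u} \<times> {v} \<times> Fp p \<subseteq> (X \<times> Y \<times> Z) <#>\<^bsub>Mgrp p n\<^esub> (X \<times> Y \<times> Z)"
proof clarify
  fix w assume "w \<in> Fp p"
  moreover have "symm p n X u \<subseteq> Fvec p n" "symm p n Y v \<subseteq> Fvec p n"
    using XY by (auto simp: symm_def)
  \<comment> \<open>With both third coordinates equal to \<open>z\<close> and the sum
    \<open>v\<close> fixed, the carry depends on \<open>y\<close> alone and can be absorbed into
    \<open>g\<close>.\<close>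
  ultimately obtain x y where x: "x \<in> symm p n X u" and y: "y \<in> symm p n Y v"
    and w: "(dotp n x y + (z + z + carry p n (vsub p n v y) y)) mod int p = w"
    using affine_form_surjective[OF p _ _ big, where w = w
        and g = "\<lambda>y. z + z + carry p n (vsub p n v y) y"] by blast
  \<comment> \<open>The factors are \<open>(x, v - y, z)\<close> and \<open>(u - x, y, z)\<close>,
    so the dot product in their product is that of \<open>x\<close> and \<open>y\<close>.\<close>
  have "(vadd p n x (vsub p n u x), vadd p n (vsub p n v y) y,
        (z + z + dotp n x y + carry p n (vsub p n v y) y) mod int p)
           \<in> (X \<times> Y \<times> Z) <#>\<^bsub>Mgrp p n\<^esub> (X \<times> Y \<times> Z)"
    using x y z by (intro mult_in_set_mult) (auto simp: symm_def)
  moreover have "vadd p n x (vsub p n u x) = u" "vadd p n (vsub p n v y) y = v"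
    using vadd_vsub uv vadd_commute by metis+
  moreover have "(z + z + dotp n x y + carry p n (vsub p n v y) y) mod int p = w"
    unfolding w[symmetric] by (simp add: add_ac)
  ultimately show "(u, v, w) \<in> (X \<times> Y \<times> Z) <#>\<^bsub>Mgrp p n\<^esub> (X \<times> Y \<times> Z)"
    by simp
qed

lemma card_rcosets_large_third:
  assumes p: "prime p" and X: "X \<subseteq> Fvec p n" "X \<noteq> {}" and Y: "Y \<subseteq> Fvec p n" "Y \<noteq> {}"
    and Z: "Z \<subseteq> Fp p" "2 * card Z > p"
  shows "card X * card Y \<le> card {C \<in> rcosets\<^bsub>Mgrp p n\<^esub> (Mcenter p n).
           C \<subseteq> (X \<times> Y \<times> Z) <#>\<^bsub>Mgrp p n\<^esub> (X \<times> Y \<times> Z)}"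
proof -
  have p0: "p > 0" using p prime_gt_0_nat by auto
  obtain x0 y0 where x0: "x0 \<in> X" and y0: "y0 \<in> Y" using X Y by auto
  \<comment> \<open>Translates by one fixed element of each set already give enough pairs, as
    translation is injective.\<close>
  let ?G = "(\<lambda>x. vadd p n x x0) ` X \<times> (\<lambda>y. vadd p n y y0) ` Y"
  have "card X * card Y = card ?G"
    using inj_on_subset[OF inj_on_vadd X(1)] inj_on_subset[OF inj_on_vadd Y(1)]
    by (simp add: card_cartesian_product card_image)
  also have "\<dots> \<le> card {C \<in> rcosets\<^bsub>Mgrp p n\<^esub> (Mcenter p n).
           C \<subseteq> (X \<times> Y \<times> Z) <#>\<^bsub>Mgrp p n\<^esub> (X \<times> Y \<times> Z)}"
  proof (rule card_rcosets_ge[OF p])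
    show "?G \<subseteq> Fvec p n \<times> Fvec p n"
      using vadd_in_Fvec[OF p0] by blast
    fix u v assume "(u, v) \<in> ?G"
    then obtain x y where x: "x \<in> X" "u = vadd p n x x0" and y: "y \<in> Y" "v = vadd p n y y0"
      by blast
    show "{u} \<times> {v} \<times> Fp p \<subseteq> (X \<times> Y \<times> Z) <#>\<^bsub>Mgrp p n\<^esub> (X \<times> Y \<times> Z)"
    proof clarify
      fix w assume "w \<in> Fp p"
      then obtain z z' where z: "z \<in> Z" "z' \<in> Z" "(z + z' + (dotp n x y0 + carry p n y y0)) mod int p = w"
        using Fp_sumset_full[OF p0 Z] by blast
      then show "(u, v, w) \<in> (X \<times> Y \<times> Z) <#>\<^bsub>Mgrp p n\<^esub> (X \<times> Y \<times> Z)"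
        using mult_in_set_mult[OF x(1) x0 y(1) y0 z(1,2), of p n] x y by (simp add: add.assoc)
    qed
  qed
  finally show ?thesis .
qed

lemma card_rcosets_small_third:
  assumes p: "prime p" and X: "X \<subseteq> Fvec p n" "X \<noteq> {}" and Y: "Y \<subseteq> Fvec p n" "Y \<noteq> {}"
    and Z: "Z \<noteq> {}" and big: "(card X * card Y)\<^sup>2 \<ge> 2 * p ^ (3 * n + 2)"
  shows "card X * card Y \<le> 2 * card {C \<in> rcosets\<^bsub>Mgrp p n\<^esub> (Mcenter p n).
           C \<subseteq> (X \<times> Y \<times> Z) <#>\<^bsub>Mgrp p n\<^esub> (X \<times> Y \<times> Z)}"
proof -
  have p0: "p > 0" using p prime_gt_0_nat by auto
  obtain z where z: "z \<in> Z" using Z by auto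
  let ?G = "{(u, v) \<in> Fvec p n \<times> Fvec p n. card (symm p n X u) * card (symm p n Y v) > p ^ (n + 2)}"
  have "2 * p ^ (2 * n) * p ^ (n + 2) = 2 * p ^ (3 * n + 2)"
    by (simp only: mult.assoc power_add[symmetric]) simp
  then have "card X * card Y \<le> 2 * card ?G"
    using big by (intro card_popular_pairs[OF p0 X Y]) (simp only:)
  moreover have "card ?G \<le> card {C \<in> rcosets\<^bsub>Mgrp p n\<^esub> (Mcenter p n).
           C \<subseteq> (X \<times> Y \<times> Z) <#>\<^bsub>Mgrp p n\<^esub> (X \<times> Y \<times> Z)}"
    using popular_fibre_full[OF p X(1) Y(1) z] by (intro card_rcosets_ge[OF p]) auto
  ultimately show ?thesis by linarith
qed

section \<open>Size estimate and conclusion\<close>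

text \<open>Since \<open>k \<le> p / 2\<close>, the hypothesis yields
  \<open>m \<ge> 2 * p powr (e - 1)\<close> with
  \<open>e = (2 * n + 1) * (3/4 + \<epsilon>)\<close>. Squaring gives exponent
  \<open>2 * e - 2\<close>, and \<open>n * \<epsilon> \<ge> 1\<close> supplies the term
  \<open>4 * n * \<epsilon> \<ge> 4\<close> that lifts it above \<open>3 * n + 2\<close>.\<close>

lemma square_ge_of_large_product:
  fixes m k p :: nat and \<epsilon> :: real
  assumes p: "p \<ge> 2" and \<epsilon>: "\<epsilon> > 0" and n: "real n \<ge> 1 / \<epsilon>" and k: "2 * k \<le> p"
    and big: "real (m * k) > real (p ^ (2 * n + 1)) powr (3/4 + \<epsilon>)"
  shows "m\<^sup>2 \<ge> 2 * p ^ (3 * n + 2)"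
proof -
  let ?P = "real p"
  have P: "?P > 1" using p by simp
  define e where "e = (2 * real n + 1) * (3/4 + \<epsilon>)"
  have "n * \<epsilon> \<ge> 1" using n \<epsilon> by (simp add: field_simps)
  then have e: "2 * e - 2 \<ge> 3 * real n + 2"
    using \<epsilon> by (simp add: e_def algebra_simps add_divide_distrib)
  have "real (p ^ (2 * n + 1)) powr (3/4 + \<epsilon>) = ?P powr e"
  proof -
    have "real (p ^ (2 * n + 1)) = ?P powr (2 * real n + 1)"
      using P powr_realpow[of ?P "2 * n + 1"] by simp
    then show ?thesis by (simp only: powr_powr e_def)
  qed
  then have "?P powr e < m * k" using big by simp
  also have "\<dots> \<le> m * (?P / 2)"
    using k by (simp only: of_nat_mult, intro mult_left_mono) linarith+
  finally have "2 * ?P powr (e - 1) \<le> m"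
    using P by (simp add: powr_diff field_simps)
  then have "(2 * ?P powr (e - 1))\<^sup>2 \<le> (real m)\<^sup>2"
    by (intro power_mono) auto
  moreover have "(2 * ?P powr (e - 1))\<^sup>2 = 4 * ?P powr (2 * e - 2)"
    by (simp add: power2_eq_square algebra_simps flip: powr_add)
  moreover have "?P powr (3 * real n + 2) \<le> ?P powr (2 * e - 2)"
    using e P by simp
  moreover have "?P powr (3 * real n + 2) = ?P ^ (3 * n + 2)"
    using P powr_realpow[of ?P "3 * n + 2"] by (simp add: add.commute)
  moreover have "?P ^ (3 * n + 2) \<ge> 0" by simp
  ultimately have "real (2 * p ^ (3 * n + 2)) \<le> real (m\<^sup>2)"
    unfolding of_nat_mult of_nat_power of_nat_numeral by linarith
  then show ?thesis by (simp only: of_nat_le_iff)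
qed

theorem theorem1p2:
  shows "\<forall>\<epsilon>>0::real. \<exists>n\<^sub>0::nat. n\<^sub>0 > 0 \<and>
    (\<forall>p n B. prime p \<longrightarrow> n \<ge> n\<^sub>0 \<longrightarrow> brick p n B \<longrightarrow>
       real (card B) > real (order (Mgrp p n)) powr (3/4 + \<epsilon>) \<longrightarrow>
       group_center (Mgrp p n) = Mcenter p n \<and>
       subgroup (Mcenter p n) (Mgrp p n) \<and>
       Mcenter p n \<noteq> {\<one>\<^bsub>Mgrp p n\<^esub>} \<and>
       real (card {C \<in> rcosets\<^bsub>Mgrp p n\<^esub> (Mcenter p n). C \<subseteq> B <#>\<^bsub>Mgrp p n\<^esub> B})
         \<ge> real (card B) / real p)"
proof (intro allI impI)
  fix \<epsilon> :: real assume \<epsilon>: "\<epsilon> > 0"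
  \<comment> \<open>This choice makes \<open>n * \<epsilon> \<ge> 1\<close> for all
    \<open>n \<ge> n0\<close>.\<close>
  define n0 where "n0 = nat \<lceil>1 / \<epsilon>\<rceil>"
  have "real (card {C \<in> rcosets\<^bsub>Mgrp p n\<^esub> (Mcenter p n). C \<subseteq> B <#>\<^bsub>Mgrp p n\<^esub> B}) \<ge> real (card B) / real p"
    (is "real ?N \<ge> _")
    if p: "prime p" and n: "n \<ge> n0" and brick: "brick p n B"
      and big: "real (card B) > real (order (Mgrp p n)) powr (3/4 + \<epsilon>)" for p n B
  proof -
    have p2: "p \<ge> 2" using p prime_ge_2_nat by auto
    from brick obtain X' Y' Z where
      X': "\<forall>i\<in>{1..n}. X' i \<noteq> {} \<and> X' i \<subseteq> Fp p" and Y': "\<forall>i\<in>{1..n}. Y' i \<noteq> {} \<and> Y' i \<subseteq> Fp p"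
      and Z: "Z \<noteq> {}" "Z \<subseteq> Fp p" and B': "B = Pi\<^sub>E {1..n} X' \<times> Pi\<^sub>E {1..n} Y' \<times> Z"
      unfolding brick_def by auto
    define X where "X = Pi\<^sub>E {1..n} X'"
    define Y where "Y = Pi\<^sub>E {1..n} Y'"
    have B: "B = X \<times> Y \<times> Z" by (simp add: B' X_def Y_def)
    have X: "X \<subseteq> Fvec p n" "X \<noteq> {}"
      unfolding X_def using X' by (auto intro!: PiE_mono simp: PiE_eq_empty_iff)
    have Y: "Y \<subseteq> Fvec p n" "Y \<noteq> {}"
      unfolding Y_def using Y' by (auto intro!: PiE_mono simp: PiE_eq_empty_iff)
    have cB: "card B = card X * card Y * card Z"
      by (simp add: B card_cartesian_product)
    have "card B \<le> ?N * p"
    \<comment> \<open>The factor 2 lost in the second case is recovered from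
      \<open>2 * card Z \<le> p\<close>; the first case loses nothing and needs only
      \<open>card Z \<le> p\<close>.\<close>
    proof (cases "2 * card Z > p")
      case True
      have "card X * card Y \<le> ?N"
        unfolding B by (rule card_rcosets_large_third[OF p X Y Z(2) True])
      moreover have "card Z \<le> p"
        using card_mono[OF finite_Fp Z(2)] by (simp add: card_Fp)
      ultimately show ?thesis
        unfolding cB by (rule mult_le_mono)
    next
      case False
      have "(card X * card Y)\<^sup>2 \<ge> 2 * p ^ (3 * n + 2)"
      proof (rule square_ge_of_large_product[OF p2 \<epsilon>])
        show "real n \<ge> 1 / \<epsilon>" using n unfolding n0_def by linarith
        show "2 * card Z \<le> p" using False by simp
        show "real (p ^ (2 * n + 1)) powr (3/4 + \<epsilon>) < real (card X * card Y * card Z)"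
          using big by (simp only: order_Mgrp cB)
      qed
      then have "card X * card Y \<le> 2 * ?N"
        unfolding B by (rule card_rcosets_small_third[OF p X Y Z(1)])
      then have "card B \<le> 2 * ?N * card Z"
        unfolding cB by (rule mult_le_mono1)
      also have "\<dots> = ?N * (2 * card Z)" by simp
      also have "\<dots> \<le> ?N * p"
        using False by (intro mult_le_mono2) simp
      finally show ?thesis .
    qed
    then have "real (card B) \<le> real ?N * real p"
      by (simp only: of_nat_le_iff flip: of_nat_mult)
    then show ?thesis using p2 by (simp add: field_simps)
  qed
  moreover have "n0 > 0" using \<epsilon> by (simp add: n0_def)
  ultimately show "\<exists>n\<^sub>0::nat. n\<^sub>0 > 0 \<and>
    (\<forall>p n B. prime p \<longrightarrow> n \<ge> n\<^sub>0 \<longrightarrow> brick p n B \<longrightarrow>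
       real (card B) > real (order (Mgrp p n)) powr (3/4 + \<epsilon>) \<longrightarrow>
       group_center (Mgrp p n) = Mcenter p n \<and>
       subgroup (Mcenter p n) (Mgrp p n) \<and>
       Mcenter p n \<noteq> {\<one>\<^bsub>Mgrp p n\<^esub>} \<and>
       real (card {C \<in> rcosets\<^bsub>Mgrp p n\<^esub> (Mcenter p n). C \<subseteq> B <#>\<^bsub>Mgrp p n\<^esub> B})
         \<ge> real (card B) / real p)"
    using group_center_Mgrp subgroup_Mcenter Mcenter_nontrivial by (intro exI[of _ n0]) auto
qed

end
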